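(* Let $n\ge p\ge 1$ be integers and let $Q(n,p)=L(n,p)/L(n,p-1)$. Then $Q(n,p)$ is a $0$-$E$-unitary categorical inverse semigroup.
   Context: Let $X_n=\{1,2,\dots,n\}$ and let $\mathcal{I}_n$ be the symmetric inverse semigroup of all partial injective maps of $X_n$ (including the empty map). Maps are written on the right and composed left to right: $x(\alpha\beta)=(x\alpha)\beta$. $\mathcal{ODP}_n$ is the subsemigroup of all $\alpha\in\mathcal{I}_n$ such that for all $x,y\in\mathrm{Dom}\,\alpha$, $|x-y|=|x\alpha-y\alpha|$, and $x\le y$ implies $x\alpha\le y\alpha$. The height of $\alpha$ is $h(\alpha)=|\mathrm{Im}\,\alpha|$. For $n\ge p\ge 0$, $L(n,p)=\{\alpha\in\mathcal{ODP}_n: h(\alpha)\le p\}$, a two-sided ideal of $\mathcal{ODP}_n$. For $p\ge 1$, $Q(n,p)=L(n,p)/L(n,p-1)$ is the Rees quotient semigroup: its nonzero elements are the elements of $\mathcal{ODP}_n$ of height exactly $p$, and the product of two of them is their product in $\mathcal{ODP}_n$ if that has height $p$, and $0$ otherwise. A semigroup $S$ with zero, with set of idempotents $E$ and $E'=E\setminus\{0\}$, is $0$-$E$-unitary if for all $e\in E'$ and $s\in S$, $es\in E'$ implies $s\in E'$. A semigroup $S$ with zero is categorical if for all $a,b,c\in S$, $abc=0$ implies $ab=0$ or $bc=0$. *)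

theory Defs
  imports Main
begin

section \<open>Semigroups on a carrier set\<close>

locale carrier_semigroup =
  fixes S :: "'a set" and mult :: "'a \<Rightarrow> 'a \<Rightarrow> 'a" (infixl "\<cdot>" 70)
  assumes closed: "a \<in> S \<Longrightarrow> b \<in> S \<Longrightarrow> a \<cdot> b \<in> S"
    and assoc: "a \<in> S \<Longrightarrow> b \<in> S \<Longrightarrow> c \<in> S \<Longrightarrow> (a \<cdot> b) \<cdot> c = a \<cdot> (b \<cdot> c)"

locale inverse_semigroup = carrier_semigroup +
  assumes unique_inverse: "a \<in> S \<Longrightarrow> \<exists>!b. b \<in> S \<and> a \<cdot> b \<cdot> a = a \<and> b \<cdot> a \<cdot> b = b"

locale semigroup_with_zero = carrier_semigroup +
  fixes zero :: 'a
  assumes zero_closed: "zero \<in> S"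
    and zero_left: "a \<in> S \<Longrightarrow> zero \<cdot> a = zero"
    and zero_right: "a \<in> S \<Longrightarrow> a \<cdot> zero = zero"

definition nonzero_idempotents :: "'a set \<Rightarrow> ('a \<Rightarrow> 'a \<Rightarrow> 'a) \<Rightarrow> 'a \<Rightarrow> 'a set" where
  "nonzero_idempotents S mult zero = {e \<in> S. mult e e = e} - {zero}"

locale zero_E_unitary_semigroup = semigroup_with_zero +
  assumes zero_E_unitary:
    "e \<in> nonzero_idempotents S mult zero \<Longrightarrow> s \<in> S \<Longrightarrow>
      e \<cdot> s \<in> nonzero_idempotents S mult zero \<Longrightarrow> s \<in> nonzero_idempotents S mult zero"

locale categorical_semigroup = semigroup_with_zero +
  assumes categorical:
    "a \<in> S \<Longrightarrow> b \<in> S \<Longrightarrow> c \<in> S \<Longrightarrow> a \<cdot> b \<cdot> c = zero \<Longrightarrow> a \<cdot> b = zero \<or> b \<cdot> c = zero"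

section \<open>Rees quotients\<close>

text \<open>For a nonempty ideal \<open>I\<close> of \<open>S\<close>, the class of the Rees congruence formed by \<open>I\<close> is
  represented by \<^term>\<open>None\<close>, and the singleton class of \<open>a \<in> S - I\<close> by \<open>Some a\<close>.\<close>

definition rees_carrier :: "'a set \<Rightarrow> 'a set \<Rightarrow> 'a option set" where
  "rees_carrier S I = insert None (Some ` (S - I))"

fun rees_mult :: "('a \<Rightarrow> 'a \<Rightarrow> 'a) \<Rightarrow> 'a set \<Rightarrow> 'a option \<Rightarrow> 'a option \<Rightarrow> 'a option" where
  "rees_mult mult I (Some a) (Some b) = (if mult a b \<in> I then None else Some (mult a b))"
| "rees_mult mult I None y = None"
| "rees_mult mult I x None = None"

section \<open>Order-preserving partial isometries of a finite chain\<close>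

definition sym_inv_semigroup :: "nat \<Rightarrow> (nat \<rightharpoonup> nat) set" where
  "sym_inv_semigroup n = {\<alpha>. dom \<alpha> \<subseteq> {1..n} \<and> ran \<alpha> \<subseteq> {1..n} \<and> inj_on \<alpha> (dom \<alpha>)}"

text \<open>Maps act on the right, so the product applies the left factor first, whereas
  \<open>\<circ>\<^sub>m\<close> applies its right argument first.\<close>

definition pmap_mult :: "(nat \<rightharpoonup> nat) \<Rightarrow> (nat \<rightharpoonup> nat) \<Rightarrow> (nat \<rightharpoonup> nat)" where
  "pmap_mult \<alpha> \<beta> = \<beta> \<circ>\<^sub>m \<alpha>"

definition ODP :: "nat \<Rightarrow> (nat \<rightharpoonup> nat) set" where
  "ODP n = {\<alpha> \<in> sym_inv_semigroup n. \<forall>x \<in> dom \<alpha>. \<forall>y \<in> dom \<alpha>.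
     \<bar>int x - int y\<bar> = \<bar>int (the (\<alpha> x)) - int (the (\<alpha> y))\<bar> \<and>
     (x \<le> y \<longrightarrow> the (\<alpha> x) \<le> the (\<alpha> y))}"

definition height :: "(nat \<rightharpoonup> nat) \<Rightarrow> nat" where
  "height \<alpha> = card (ran \<alpha>)"

definition L :: "nat \<Rightarrow> nat \<Rightarrow> (nat \<rightharpoonup> nat) set" where
  "L n p = {\<alpha> \<in> ODP n. height \<alpha> \<le> p}"

text \<open>The quotient of \<open>L n p\<close> by \<open>L n (p - 1)\<close>, meaningful for \<open>p \<ge> 1\<close> only
  (natural-number subtraction); its zero is \<^term>\<open>None\<close>.\<close>

definition Q :: "nat \<Rightarrow> nat \<Rightarrow> (nat \<rightharpoonup> nat) option set" where
  "Q n p = rees_carrier (L n p) (L n (p - 1))"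

definition Q_mult :: "nat \<Rightarrow> nat \<Rightarrow>
    (nat \<rightharpoonup> nat) option \<Rightarrow> (nat \<rightharpoonup> nat) option \<Rightarrow> (nat \<rightharpoonup> nat) option" where
  "Q_mult n p = rees_mult pmap_mult (L n (p - 1))"

end

theory Submission
  imports Defs
begin

text \<open>A member of \<open>ODP n\<close> is a restriction of a translation, so a nonempty one is determined by its
  domain and its range. For \<open>\<alpha>\<close> and \<open>\<beta>\<close> of height \<open>p\<close> the product has height \<open>p\<close> exactly when
  \<open>ran \<alpha> = dom \<beta>\<close>, and it then leads from \<open>dom \<alpha>\<close> to \<open>ran \<beta>\<close>. Hence \<open>Q n p\<close> is a groupoid
  with a zero adjoined, in which there is at most one arrow between two objects; its nonzero
  idempotents are the arrows with \<open>dom \<alpha> = ran \<alpha>\<close>, and all claims are read off from domains and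
  ranges.\<close>

section \<open>Partial translations of the chain\<close>

text \<open>Preserving order fixes the sign of each difference and the isometry condition fixes its
  absolute value. Injectivity comes for free, as equal values force difference zero.\<close>

lemma ODP_iff:
  "\<alpha> \<in> ODP n \<longleftrightarrow>
    (\<forall>x y. \<alpha> x = Some y \<longrightarrow> x \<in> {1..n} \<and> y \<in> {1..n}) \<and>
    (\<forall>x y x' y'. \<alpha> x = Some y \<longrightarrow> \<alpha> x' = Some y' \<longrightarrow> int y' - int y = int x' - int x)"
  (is "_ \<longleftrightarrow> ?B \<and> ?T")
proof
  assume a: "\<alpha> \<in> ODP n"
  have ?B
    using a by (auto simp: ODP_def sym_inv_semigroup_def ran_def dom_def)
  moreover have "int y' - int y = int x' - int x" if "\<alpha> x = Some y" "\<alpha> x' = Some y'" for x y x' y'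
  proof -
    have "\<bar>int u - int v\<bar> = \<bar>int (the (\<alpha> u)) - int (the (\<alpha> v))\<bar> \<and>
        (u \<le> v \<longrightarrow> the (\<alpha> u) \<le> the (\<alpha> v))" if "u \<in> dom \<alpha>" "v \<in> dom \<alpha>" for u v
      using a that unfolding ODP_def by blast
    \<comment> \<open>Both orders of the pair are needed, since either point may be the smaller
      one.\<close>
    from this[of x x'] this[of x' x] that show ?thesis
      by (auto simp: dom_def)
  qed
  ultimately show "?B \<and> ?T" by blast
next
  assume r: "?B \<and> ?T"
  have "inj_on \<alpha> (dom \<alpha>)"
  proof (rule inj_onI)
    fix x x' assume "x \<in> dom \<alpha>" "x' \<in> dom \<alpha>" "\<alpha> x = \<alpha> x'"
    then obtain y where "\<alpha> x = Some y" "\<alpha> x' = Some y" by auto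
    with r have "int y - int y = int x' - int x" by blast
    then show "x = x'" by simp
  qed
  moreover have "dom \<alpha> \<subseteq> {1..n}" "ran \<alpha> \<subseteq> {1..n}"
    using r by (auto simp: ran_def dom_def)
  moreover have "\<bar>int x - int x'\<bar> = \<bar>int (the (\<alpha> x)) - int (the (\<alpha> x'))\<bar> \<and>
      (x \<le> x' \<longrightarrow> the (\<alpha> x) \<le> the (\<alpha> x'))" if "x \<in> dom \<alpha>" "x' \<in> dom \<alpha>" for x x'
  proof -
    from that obtain y y' where y: "\<alpha> x = Some y" "\<alpha> x' = Some y'" by auto
    with r have "int y' - int y = int x' - int x" by blast
    then show ?thesis using y by auto
  qed
  ultimately show "\<alpha> \<in> ODP n"
    unfolding ODP_def sym_inv_semigroup_def by blast
qed

lemma ODP_bounds: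
  assumes "\<alpha> \<in> ODP n" "\<alpha> x = Some y"
  shows "x \<in> {1..n}" "y \<in> {1..n}"
  using assms by (auto simp: ODP_iff)

lemma ODP_translation:
  assumes "\<alpha> \<in> ODP n" "\<alpha> x = Some y" "\<alpha> x' = Some y'"
  shows "int y' - int y = int x' - int x"
  using assms unfolding ODP_iff by blast

lemma ODP_finite_dom: "\<alpha> \<in> ODP n \<Longrightarrow> finite (dom \<alpha>)"
  by (rule finite_subset[of _ "{1..n}"]) (auto dest: ODP_bounds)

lemma ODP_inj:
  assumes "\<alpha> \<in> ODP n" "\<alpha> x = Some y" "\<alpha> x' = Some y"
  shows "x = x'"
  using ODP_translation[OF assms] by simp

text \<open>\<open>height\<close> counts the range; injectivity lets it be counted on the domain,
  where the effect of a product is easiest to see.\<close>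

lemma ODP_card_dom:
  assumes "\<alpha> \<in> ODP n"
  shows "card (dom \<alpha>) = height \<alpha>"
proof -
  have "inj_on (\<lambda>x. the (\<alpha> x)) (dom \<alpha>)"
    using ODP_inj[OF assms] by (auto intro!: inj_onI)
  moreover have "ran \<alpha> = (\<lambda>x. the (\<alpha> x)) ` dom \<alpha>"
    by (force simp: ran_def)
  ultimately show ?thesis
    by (simp add: height_def card_image)
qed

section \<open>Products, equality and inverses of partial translations\<close>

lemma pmap_mult_eq_Some_iff:
  "pmap_mult \<alpha> \<beta> x = Some z \<longleftrightarrow> (\<exists>y. \<alpha> x = Some y \<and> \<beta> y = Some z)"
  by (auto simp: pmap_mult_def map_comp_Some_iff)

lemma pmap_mult_assoc: "pmap_mult (pmap_mult \<alpha> \<beta>) \<gamma> = pmap_mult \<alpha> (pmap_mult \<beta> \<gamma>)"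
  by (rule ext) (simp add: pmap_mult_def map_comp_def split: option.split)

lemma dom_pmap_mult_subset: "dom (pmap_mult \<alpha> \<beta>) \<subseteq> dom \<alpha>"
  by (auto simp: pmap_mult_eq_Some_iff)

lemma ran_pmap_mult_subset: "ran (pmap_mult \<alpha> \<beta>) \<subseteq> ran \<beta>"
  by (auto simp: ran_def pmap_mult_eq_Some_iff)

lemma pmap_mult_in_ODP:
  assumes "\<alpha> \<in> ODP n" "\<beta> \<in> ODP n"
  shows "pmap_mult \<alpha> \<beta> \<in> ODP n"
  unfolding ODP_iff
proof (intro conjI allI impI)
  fix x z assume "pmap_mult \<alpha> \<beta> x = Some z"
  then show "x \<in> {1..n}" "z \<in> {1..n}"
    using ODP_bounds assms unfolding pmap_mult_eq_Some_iff by blast+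
next
  fix x z x' z' assume "pmap_mult \<alpha> \<beta> x = Some z" "pmap_mult \<alpha> \<beta> x' = Some z'"
  then obtain y y' where "\<alpha> x = Some y" "\<beta> y = Some z" "\<alpha> x' = Some y'" "\<beta> y' = Some z'"
    unfolding pmap_mult_eq_Some_iff by blast
  then show "int z' - int z = int x' - int x"
    using ODP_translation assms by metis
qed

text \<open>A translation takes the least point of its domain to the least point of its range, so
  domain and range fix the shift. The empty map has no least point and is treated apart.\<close>

lemma ODP_eqI:
  assumes \<alpha>: "\<alpha> \<in> ODP n" and \<beta>: "\<beta> \<in> ODP n"
    and dom: "dom \<alpha> = dom \<beta>" and ran: "ran \<alpha> = ran \<beta>"
  shows "\<alpha> = \<beta>"
proof (cases "dom \<alpha> = {}")
  case True
  with dom have "dom \<beta> = {}" by simp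
  with True show ?thesis unfolding dom_eq_empty_conv by simp
next
  case False
  define m where "m = Min (dom \<alpha>)"
  have m: "m \<in> dom \<alpha>" "\<And>x. x \<in> dom \<alpha> \<Longrightarrow> m \<le> x"
    using False ODP_finite_dom[OF \<alpha>] by (auto simp: m_def)
  then obtain a b where a: "\<alpha> m = Some a" and b: "\<beta> m = Some b"
    using dom by blast
  have "a \<le> y" if "y \<in> ran \<alpha>" for y
  proof -
    from that obtain x where x: "\<alpha> x = Some y" by (auto simp: ran_def)
    then have "m \<le> x" using m(2) by blast
    with ODP_translation[OF \<alpha> a x] show ?thesis by linarith
  qed
  moreover have "b \<le> y" if "y \<in> ran \<beta>" for y
  proof -
    from that obtain x where x: "\<beta> x = Some y" by (auto simp: ran_def)
    then have "m \<le> x" using m(2) dom by blast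
    with ODP_translation[OF \<beta> b x] show ?thesis by linarith
  qed
  moreover have "a \<in> ran \<alpha>" "b \<in> ran \<beta>" using a b by (auto intro: ranI)
  ultimately have ab: "a = b" using ran by (blast intro: le_antisym)
  show ?thesis
  proof
    fix x
    show "\<alpha> x = \<beta> x"
    proof (cases "x \<in> dom \<alpha>")
      case True
      then obtain y z where y: "\<alpha> x = Some y" and z: "\<beta> x = Some z"
        using dom by blast
      from ODP_translation[OF \<alpha> a y] ODP_translation[OF \<beta> b z] ab y z
      show ?thesis by simp
    next
      case False
      then show ?thesis using dom by (metis domIff)
    qed
  qed
qed

lemma ODP_inverse:
  assumes \<alpha>: "\<alpha> \<in> ODP n"
  obtains \<beta> where "\<beta> \<in> ODP n" "dom \<beta> = ran \<alpha>" "ran \<beta> = dom \<alpha>"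
proof -
  \<comment> \<open>The choice is forced, because \<open>\<alpha>\<close> is injective. Thus the
    graph of \<open>\<beta>\<close> is the converse of that of \<open>\<alpha>\<close>, and each
    claim about \<open>\<beta>\<close> becomes one about \<open>\<alpha>\<close>.\<close>
  define \<beta> where "\<beta> y = (if y \<in> ran \<alpha> then Some (SOME x. \<alpha> x = Some y) else None)" for y
  have \<beta>: "\<beta> y = Some x \<longleftrightarrow> \<alpha> x = Some y" for x y
  proof (cases "y \<in> ran \<alpha>")
    case True
    then obtain x' where "\<alpha> x' = Some y" by (auto simp: ran_def)
    then have "\<alpha> (SOME x. \<alpha> x = Some y) = Some y" by (rule someI)
    with True ODP_inj[OF \<alpha>] show ?thesis by (auto simp: \<beta>_def)
  qed (auto simp: \<beta>_def ran_def)
  show ?thesis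
  proof
    show "\<beta> \<in> ODP n"
      unfolding ODP_iff \<beta>
    proof (intro conjI allI impI)
      fix x y assume "\<alpha> x = Some y"
      then show "y \<in> {1..n}" "x \<in> {1..n}"
        using ODP_bounds[OF \<alpha>] by blast+
    next
      fix x y x' y' assume "\<alpha> x = Some y" "\<alpha> x' = Some y'"
      then show "int x' - int x = int y' - int y"
        by (rule ODP_translation[OF \<alpha>, symmetric])
    qed
    show "dom \<beta> = ran \<alpha>" "ran \<beta> = dom \<alpha>"
      by (auto simp: dom_def ran_def \<beta>)
  qed
qed

section \<open>Maps of height exactly \<open>p\<close>\<close>

text \<open>For \<open>1 \<le> p\<close> these are the nonzero elements of \<open>Q n p\<close>,
  stripped of \<open>Some\<close>.\<close>

definition ODP_of_height :: "nat \<Rightarrow> nat \<Rightarrow> (nat \<rightharpoonup> nat) set" where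
  "ODP_of_height n p = {\<alpha> \<in> ODP n. height \<alpha> = p}"

lemma Q_eq:
  assumes "1 \<le> p"
  shows "Q n p = insert None (Some ` ODP_of_height n p)"
proof -
  have "L n p - L n (p - 1) = ODP_of_height n p"
    using assms by (auto simp: L_def ODP_of_height_def)
  then show ?thesis by (simp add: Q_def rees_carrier_def)
qed

text \<open>No point of \<open>dom \<alpha>\<close> is lost, as its image lies in
  \<open>dom \<beta>\<close>, and no value of \<open>\<beta>\<close> is lost, as every point of
  \<open>dom \<beta>\<close> is reached. The height is then read off the domain.\<close>

lemma pmap_mult_composable:
  assumes \<alpha>: "\<alpha> \<in> ODP_of_height n p" and \<beta>: "\<beta> \<in> ODP_of_height n p" and "ran \<alpha> = dom \<beta>"
  shows "pmap_mult \<alpha> \<beta> \<in> ODP_of_height n p"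
    and "dom (pmap_mult \<alpha> \<beta>) = dom \<alpha>" and "ran (pmap_mult \<alpha> \<beta>) = ran \<beta>"
proof -
  have odp: "pmap_mult \<alpha> \<beta> \<in> ODP n"
    using \<alpha> \<beta> by (auto simp: ODP_of_height_def intro: pmap_mult_in_ODP)
  have "dom \<alpha> \<subseteq> dom (pmap_mult \<alpha> \<beta>)"
  proof
    fix x assume "x \<in> dom \<alpha>"
    then obtain y where y: "\<alpha> x = Some y" by blast
    then have "y \<in> dom \<beta>" unfolding assms(3)[symmetric] by (rule ranI)
    with y show "x \<in> dom (pmap_mult \<alpha> \<beta>)" unfolding dom_def by (auto simp: pmap_mult_def)
  qed
  then show d: "dom (pmap_mult \<alpha> \<beta>) = dom \<alpha>"
    by (rule equalityI[OF dom_pmap_mult_subset])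
  show "pmap_mult \<alpha> \<beta> \<in> ODP_of_height n p"
    using odp \<alpha> ODP_card_dom[OF odp] ODP_card_dom[of \<alpha> n]
    unfolding ODP_of_height_def d by simp
  have "ran \<beta> \<subseteq> ran (pmap_mult \<alpha> \<beta>)"
  proof
    fix z assume "z \<in> ran \<beta>"
    then obtain y where y: "\<beta> y = Some z" by (auto simp: ran_def)
    then have "y \<in> ran \<alpha>" unfolding assms(3) by (rule domI)
    with y show "z \<in> ran (pmap_mult \<alpha> \<beta>)" by (auto simp: ran_def pmap_mult_eq_Some_iff)
  qed
  then show "ran (pmap_mult \<alpha> \<beta>) = ran \<beta>"
    by (rule equalityI[OF ran_pmap_mult_subset])
qed

text \<open>The sets \<open>ran \<alpha>\<close> and \<open>dom \<beta>\<close> both have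
  \<open>p\<close> elements, so if they differ, some value of \<open>\<alpha>\<close> lies outside
  \<open>dom \<beta>\<close> and the product loses a point of the domain.\<close>

lemma pmap_mult_in_L_iff:
  assumes \<alpha>: "\<alpha> \<in> ODP_of_height n p" and \<beta>: "\<beta> \<in> ODP_of_height n p" and p: "1 \<le> p"
  shows "pmap_mult \<alpha> \<beta> \<in> L n (p - 1) \<longleftrightarrow> ran \<alpha> \<noteq> dom \<beta>"
proof
  assume "pmap_mult \<alpha> \<beta> \<in> L n (p - 1)"
  \<comment> \<open>A product of height \<open>p\<close> would give \<open>p \<le> p - 1\<close>,
    which truncated subtraction allows only at \<open>p = 0\<close>.\<close>
  then show "ran \<alpha> \<noteq> dom \<beta>"
    using pmap_mult_composable(1)[OF \<alpha> \<beta>] p by (auto simp: L_def ODP_of_height_def)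
next
  assume ne: "ran \<alpha> \<noteq> dom \<beta>"
  have \<alpha>': "\<alpha> \<in> ODP n" "card (dom \<alpha>) = p" "card (ran \<alpha>) = p"
    and \<beta>': "\<beta> \<in> ODP n" "card (dom \<beta>) = p"
    using \<alpha> \<beta> ODP_card_dom by (auto simp: ODP_of_height_def height_def)
  have odp: "pmap_mult \<alpha> \<beta> \<in> ODP n"
    using \<alpha>'(1) \<beta>'(1) by (rule pmap_mult_in_ODP)
  have "\<not> ran \<alpha> \<subseteq> dom \<beta>"
    using card_subset_eq[OF ODP_finite_dom[OF \<beta>'(1)]] \<alpha>'(3) \<beta>'(2) ne by metis
  then obtain x y where "\<alpha> x = Some y" "y \<notin> dom \<beta>"
    by (auto simp: ran_def)
  then have "x \<in> dom \<alpha>" "x \<notin> dom (pmap_mult \<alpha> \<beta>)"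
    by (auto simp: pmap_mult_eq_Some_iff)
  then have "dom (pmap_mult \<alpha> \<beta>) \<subset> dom \<alpha>"
    using dom_pmap_mult_subset[of \<alpha> \<beta>] by blast
  then have "card (dom (pmap_mult \<alpha> \<beta>)) < p"
    using psubset_card_mono[OF ODP_finite_dom[OF \<alpha>'(1)]] \<alpha>'(2) by metis
  then show "pmap_mult \<alpha> \<beta> \<in> L n (p - 1)"
    using odp by (simp add: L_def ODP_card_dom)
qed

lemma Q_mult_Some:
  assumes "\<alpha> \<in> ODP_of_height n p" "\<beta> \<in> ODP_of_height n p" "1 \<le> p"
  shows "Q_mult n p (Some \<alpha>) (Some \<beta>) =
    (if ran \<alpha> = dom \<beta> then Some (pmap_mult \<alpha> \<beta>) else None)"
  using pmap_mult_in_L_iff[OF assms] by (simp add: Q_mult_def)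

lemma Q_mult_None [simp]: "Q_mult n p None b = None" "Q_mult n p a None = None"
  unfolding Q_mult_def by (simp, cases a) simp_all

lemma ODP_of_height_eqI:
  assumes "\<alpha> \<in> ODP_of_height n p" "\<beta> \<in> ODP_of_height n p" "dom \<alpha> = dom \<beta>" "ran \<alpha> = ran \<beta>"
  shows "\<alpha> = \<beta>"
  using assms ODP_eqI by (auto simp: ODP_of_height_def)

lemma ODP_of_height_inverse:
  assumes "\<alpha> \<in> ODP_of_height n p"
  obtains \<beta> where "\<beta> \<in> ODP_of_height n p" "dom \<beta> = ran \<alpha>" "ran \<beta> = dom \<alpha>"
proof -
  have "\<alpha> \<in> ODP n" and h: "height \<alpha> = p"
    using assms by (auto simp: ODP_of_height_def)
  from this(1) obtain \<beta> where "\<beta> \<in> ODP n" "dom \<beta> = ran \<alpha>" "ran \<beta> = dom \<alpha>"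
    by (rule ODP_inverse)
  moreover have "height \<beta> = p"
    using ODP_card_dom[OF \<open>\<alpha> \<in> ODP n\<close>] h \<open>ran \<beta> = dom \<alpha>\<close> by (simp add: height_def)
  ultimately show ?thesis using that by (simp add: ODP_of_height_def)
qed

section \<open>Properties of the Rees quotient\<close>

lemma Q_cases:
  assumes "a \<in> Q n p" "1 \<le> p"
  obtains "a = None" | \<alpha> where "a = Some \<alpha>" "\<alpha> \<in> ODP_of_height n p"
  using assms by (auto simp: Q_eq)

text \<open>For nonzero factors, either bracketing of \<open>a\<close>, \<open>b\<close>,
  \<open>c\<close> is nonzero exactly when both adjacent pairs are composable, because a composable
  product keeps the outer domain and range.\<close>

lemma Q_semigroup_with_zero:
  assumes p: "1 \<le> p"
  shows "semigroup_with_zero (Q n p) (Q_mult n p) None"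
proof
  fix a b assume "a \<in> Q n p" "b \<in> Q n p"
  then show "Q_mult n p a b \<in> Q n p"
    using p by (auto simp: Q_eq Q_mult_Some pmap_mult_composable)
next
  fix a b c assume "a \<in> Q n p" "b \<in> Q n p" "c \<in> Q n p"
  then show "Q_mult n p (Q_mult n p a b) c = Q_mult n p a (Q_mult n p b c)"
    using p by (auto simp: Q_eq Q_mult_Some pmap_mult_composable pmap_mult_assoc)
qed (simp_all add: Q_eq[OF p])

lemma Q_inverse_semigroup:
  assumes p: "1 \<le> p"
  shows "inverse_semigroup (Q n p) (Q_mult n p)"
proof -
  interpret semigroup_with_zero "Q n p" "Q_mult n p" None
    using p by (rule Q_semigroup_with_zero)
  show ?thesis
  proof
    fix a assume "a \<in> Q n p"
    then show "\<exists>!b. b \<in> Q n p \<and> Q_mult n p (Q_mult n p a b) a = a \<and> Q_mult n p (Q_mult n p b a) b = b"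
      using p
    proof (cases rule: Q_cases)
      \<comment> \<open>The zero is its own only inverse: a product containing it is zero, so the
        second equation forces \<open>b = None\<close>.\<close>
      case 1
      then show ?thesis by (auto simp: Q_eq[OF p])
    next
      case (2 \<alpha>)
      obtain \<beta> where \<beta>: "\<beta> \<in> ODP_of_height n p" "dom \<beta> = ran \<alpha>" "ran \<beta> = dom \<alpha>"
        using 2(2) by (rule ODP_of_height_inverse)
      show ?thesis
      proof (intro ex1I conjI)
        show "Some \<beta> \<in> Q n p" using \<beta> p by (simp add: Q_eq)
        \<comment> \<open>In each equation both sides have height \<open>p\<close> and the same
          domain and range.\<close>
        have "pmap_mult (pmap_mult \<alpha> \<beta>) \<alpha> = \<alpha>" "pmap_mult (pmap_mult \<beta> \<alpha>) \<beta> = \<beta>"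
          using 2 \<beta> by (intro ODP_of_height_eqI[of _ n p]; simp add: pmap_mult_composable[of _ n p])+
        then show "Q_mult n p (Q_mult n p a (Some \<beta>)) a = a"
          "Q_mult n p (Q_mult n p (Some \<beta>) a) (Some \<beta>) = Some \<beta>"
          using 2 \<beta> p by (simp_all add: Q_mult_Some pmap_mult_composable)
      next
        fix b
        assume b: "b \<in> Q n p \<and> Q_mult n p (Q_mult n p a b) a = a \<and> Q_mult n p (Q_mult n p b a) b = b"
        then obtain \<gamma> where \<gamma>: "b = Some \<gamma>" "\<gamma> \<in> ODP_of_height n p"
          using 2 p by (auto simp: Q_eq)
        \<comment> \<open>If either product vanished, the triple product starting with it would too,
          yet these equal the nonzero \<open>a\<close> and \<open>b\<close>. Composability both ways
          then fixes domain and range of \<open>\<gamma>\<close>.\<close>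
        have "Q_mult n p a b \<noteq> None" "Q_mult n p b a \<noteq> None"
          using b 2(1) \<gamma>(1) by (metis Q_mult_None(1) option.distinct(1))+
        then have "ran \<alpha> = dom \<gamma>" "ran \<gamma> = dom \<alpha>"
          using Q_mult_Some[OF 2(2) \<gamma>(2) p] Q_mult_Some[OF \<gamma>(2) 2(2) p] 2(1) \<gamma>(1)
          by (simp_all split: if_splits)
        then have "\<gamma> = \<beta>"
          by (intro ODP_of_height_eqI[OF \<gamma>(2) \<beta>(1)]) (simp_all add: \<beta>)
        then show "b = Some \<beta>" using \<gamma>(1) by simp
      qed
    qed
  qed
qed

text \<open>A nonzero square needs \<open>ran \<alpha> = dom \<alpha>\<close>; the square then has
  the domain and range of \<open>\<alpha>\<close> and so equals it.\<close>

lemma Q_nonzero_idempotents: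
  assumes p: "1 \<le> p"
  shows "nonzero_idempotents (Q n p) (Q_mult n p) None =
    Some ` {\<alpha> \<in> ODP_of_height n p. dom \<alpha> = ran \<alpha>}"
proof -
  have "Q_mult n p (Some \<alpha>) (Some \<alpha>) = Some \<alpha> \<longleftrightarrow> dom \<alpha> = ran \<alpha>" if "\<alpha> \<in> ODP_of_height n p" for \<alpha>
  proof -
    have "pmap_mult \<alpha> \<alpha> = \<alpha>" if "ran \<alpha> = dom \<alpha>"
      using \<open>\<alpha> \<in> ODP_of_height n p\<close> that
      by (intro ODP_of_height_eqI[of _ n p]) (simp_all add: pmap_mult_composable)
    with that p show ?thesis by (auto simp: Q_mult_Some)
  qed
  then show ?thesis
    using p by (auto simp: nonzero_idempotents_def Q_eq)
qed

text \<open>Write \<open>dom\<close> and \<open>ran\<close> for the underlying maps. Then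
  \<open>ran e = dom s\<close> as the product is nonzero, and \<open>dom e = ran s\<close> as it is
  idempotent. With \<open>dom e = ran e\<close> this gives \<open>dom s = ran s\<close>.\<close>

lemma Q_zero_E_unitary:
  assumes p: "1 \<le> p"
  shows "zero_E_unitary_semigroup (Q n p) (Q_mult n p) None"
proof -
  interpret semigroup_with_zero "Q n p" "Q_mult n p" None
    using p by (rule Q_semigroup_with_zero)
  show ?thesis
  proof
    fix e s
    assume "e \<in> nonzero_idempotents (Q n p) (Q_mult n p) None" "s \<in> Q n p"
      "Q_mult n p e s \<in> nonzero_idempotents (Q n p) (Q_mult n p) None"
    then show "s \<in> nonzero_idempotents (Q n p) (Q_mult n p) None"
      using p unfolding Q_nonzero_idempotents[OF p]
      by (auto simp: Q_eq Q_mult_Some pmap_mult_composable split: if_splits)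
  qed
qed

text \<open>If \<open>ab\<close> and \<open>bc\<close> are nonzero, then \<open>ab\<close> has the
  range of \<open>b\<close>, which is the domain of \<open>c\<close>, so \<open>abc\<close> is
  nonzero.\<close>

lemma Q_categorical:
  assumes p: "1 \<le> p"
  shows "categorical_semigroup (Q n p) (Q_mult n p) None"
proof -
  interpret semigroup_with_zero "Q n p" "Q_mult n p" None
    using p by (rule Q_semigroup_with_zero)
  show ?thesis
  proof
    fix a b c
    assume "a \<in> Q n p" "b \<in> Q n p" "c \<in> Q n p" "Q_mult n p (Q_mult n p a b) c = None"
    then show "Q_mult n p a b = None \<or> Q_mult n p b c = None"
      using p by (auto simp: Q_eq Q_mult_Some pmap_mult_composable split: if_splits)
  qed
qed

theorem theorem2p6:
  fixes n p :: nat
  assumes "1 \<le> p" and "p \<le> n"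
  shows "inverse_semigroup (Q n p) (Q_mult n p) \<and>
    zero_E_unitary_semigroup (Q n p) (Q_mult n p) None \<and>
    categorical_semigroup (Q n p) (Q_mult n p) None"
  using assms(1) Q_inverse_semigroup Q_zero_E_unitary Q_categorical by blast

end
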